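(* Let $p$ be a prime and let $G$ be a GGS-group acting on the $p$-adic tree with defining vector $e=(e_1,\dots,e_{p-1})$ such that $e_1+\dots+e_{p-1}\equiv 0\pmod p$. Then $G$ is super strongly fractal.
   Context: The vertices of the $p$-adic tree $T$ are the words in the free monoid $X^*$, where $X=\{x_1,\dots,x_p\}$ (identified with $\{1,\dots,p\}$); the root is the empty word $\emptyset$, and $u$ is joined to $ux$ for $x\in X$. $L_n$ is the set of words of length $n$. $\operatorname{Aut}T$ is the group of automorphisms of the rooted tree $T$, with product $(fg)(u)=g(f(u))$. For $g\in\operatorname{Aut}T$ and a vertex $u$, the section $g_u\in\operatorname{Aut}T$ is defined by $g(uv)=g(u)g_u(v)$ for all $v\in X^*$. For $g$ fixing the first level, $\psi(g)=(g_{x_1},\dots,g_{x_p})$. Let $a$ be the rooted automorphism corresponding to the cycle $(1\,\dots\,p)$, i.e. $a$ permutes the first level by this cycle and has trivial sections at all first-level vertices. Given a non-zero vector $e=(e_1,\dots,e_{p-1})\in(\mathbb{Z}/p\mathbb{Z})^{p-1}$ (the defining vector), define $b\in\operatorname{Aut}T$ fixing the first level recursively by $\psi(b)=(a^{e_1},\dots,a^{e_{p-1}},b)$. The GGS-group with defining vector $e$ is $G=\langle a,b\rangle$. For $G\le\operatorname{Aut}T$, $\operatorname{st}_G(L_n)$ is the subgroup of elements fixing every vertex of $L_n$, and $\psi_u$ is the homomorphism $g\mapsto g_u$ defined on the stabilizer of the vertex $u$. $G$ is self-similar if $g_u\in G$ for all $g\in G$ and all vertices $u$; a self-similar group $G$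 is super strongly fractal if $\psi_u(\operatorname{st}_G(L_n))=G$ for every $n\in\mathbb{N}$ and every $u\in L_n$. *)

theory Defs
  imports
    "HOL-Algebra.Bij"
    "HOL-Algebra.Generated_Groups"
    "HOL-Number_Theory.Cong"
    "HOL-Computational_Algebra.Primes"
begin

section \<open>Automorphisms of the \<open>p\<close>-adic rooted tree\<close>

text \<open>The vertices are the words over the alphabet \<open>{1,\<dots>,p}\<close>, the root being the empty word.\<close>

definition vertices :: "nat \<Rightarrow> nat list set" where
  "vertices p = lists {1..p}"

definition level :: "nat \<Rightarrow> nat \<Rightarrow> nat list set" where
  "level p n = {u \<in> vertices p. length u = n}"

definition adjacent :: "nat list \<Rightarrow> nat list \<Rightarrow> bool" where
  "adjacent u v \<longleftrightarrow> (\<exists>x. v = u @ [x] \<or> u = v @ [x])"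

definition tree_auts :: "nat \<Rightarrow> (nat list \<Rightarrow> nat list) set" where
  "tree_auts p = {f \<in> Bij (vertices p). f [] = [] \<and>
     (\<forall>u\<in>vertices p. \<forall>v\<in>vertices p. adjacent (f u) (f v) \<longleftrightarrow> adjacent u v)}"

text \<open>The product is \<open>(f g)(u) = g (f u)\<close>, the opposite of the one in \<^const>\<open>BijGroup\<close>.\<close>

definition AutT :: "nat \<Rightarrow> (nat list \<Rightarrow> nat list) monoid" where
  "AutT p = \<lparr>carrier = tree_auts p,
             monoid.mult = (\<lambda>f g. compose (vertices p) g f),
             one = (\<lambda>u\<in>vertices p. u)\<rparr>"

text \<open>
  For an automorphism \<open>g\<close>, \<open>g u\<close> is a prefix of \<open>g (u @ v)\<close> of the same length as \<open>u\<close>, so dropping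
  it gives the section; see \<open>section_at_spec\<close> and \<open>section_at_unique\<close> below.
\<close>

definition section_at :: "nat \<Rightarrow> nat list \<Rightarrow> (nat list \<Rightarrow> nat list) \<Rightarrow> nat list \<Rightarrow> nat list" where
  "section_at p u g = (\<lambda>v\<in>vertices p. drop (length u) (g (u @ v)))"

definition level_stabilizer ::
    "nat \<Rightarrow> (nat list \<Rightarrow> nat list) set \<Rightarrow> nat \<Rightarrow> (nat list \<Rightarrow> nat list) set" where
  "level_stabilizer p G n = {g \<in> G. \<forall>u\<in>level p n. g u = u}"

definition self_similar :: "nat \<Rightarrow> (nat list \<Rightarrow> nat list) set \<Rightarrow> bool" where
  "self_similar p G \<longleftrightarrow> subgroup G (AutT p) \<and> (\<forall>g\<in>G. \<forall>u\<in>vertices p. section_at p u g \<in> G)"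

definition super_strongly_fractal :: "nat \<Rightarrow> (nat list \<Rightarrow> nat list) set \<Rightarrow> bool" where
  "super_strongly_fractal p G \<longleftrightarrow> self_similar p G \<and>
     (\<forall>n. \<forall>u\<in>level p n. section_at p u ` level_stabilizer p G n = G)"


section \<open>GGS-groups\<close>

text \<open>The rooted automorphism of the cycle \<open>(1 \<dots> p)\<close>: \<open>x mod p + 1\<close> is \<open>x + 1\<close> for \<open>x < p\<close> and
  \<open>1\<close> for \<open>x = p\<close>.\<close>

definition ggs_a :: "nat \<Rightarrow> nat list \<Rightarrow> nat list" where
  "ggs_a p = (\<lambda>u\<in>vertices p. case u of [] \<Rightarrow> [] | x # v \<Rightarrow> (x mod p + 1) # v)"

text \<open>
  A defining vector is given by integer representatives \<open>e 1, \<dots>, e (p - 1)\<close> of its entries in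
  \<open>\<int>/p\<int>\<close>; as \<open>a\<close> has order \<open>p\<close>, only their residue classes matter (\<open>ggs_b_cong\<close> below).
  The values of \<open>e\<close> outside \<open>{1..p-1}\<close> are irrelevant.
\<close>

fun ggs_b_fun :: "nat \<Rightarrow> (nat \<Rightarrow> int) \<Rightarrow> nat list \<Rightarrow> nat list" where
  "ggs_b_fun p e [] = []"
| "ggs_b_fun p e (x # v) =
     x # (if x = p then ggs_b_fun p e v else (ggs_a p [^]\<^bsub>AutT p\<^esub> e x) v)"

definition ggs_b :: "nat \<Rightarrow> (nat \<Rightarrow> int) \<Rightarrow> nat list \<Rightarrow> nat list" where
  "ggs_b p e = restrict (ggs_b_fun p e) (vertices p)"

definition GGS_group :: "nat \<Rightarrow> (nat \<Rightarrow> int) \<Rightarrow> (nat list \<Rightarrow> nat list) set" where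
  "GGS_group p e = generate (AutT p) {ggs_a p, ggs_b p e}"


section \<open>Consistency of the encoding\<close>

lemma vertices_simps [simp]:
  "[] \<in> vertices p"
  "x # v \<in> vertices p \<longleftrightarrow> x \<in> {1..p} \<and> v \<in> vertices p"
  "u @ v \<in> vertices p \<longleftrightarrow> u \<in> vertices p \<and> v \<in> vertices p"
  by (auto simp: vertices_def)

lemma tree_auts_closed: "f \<in> tree_auts p \<Longrightarrow> u \<in> vertices p \<Longrightarrow> f u \<in> vertices p"
  by (auto simp: tree_auts_def Bij_def bij_betw_def)

lemma tree_auts_inj:
  "f \<in> tree_auts p \<Longrightarrow> u \<in> vertices p \<Longrightarrow> v \<in> vertices p \<Longrightarrow> f u = f v \<Longrightarrow> u = v"
  by (auto simp: tree_auts_def Bij_def bij_betw_def inj_on_def)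

lemma tree_auts_surj: "f \<in> tree_auts p \<Longrightarrow> f ` vertices p = vertices p"
  by (simp add: tree_auts_def Bij_def bij_betw_def)

lemma tree_auts_adjacent:
  "f \<in> tree_auts p \<Longrightarrow> u \<in> vertices p \<Longrightarrow> v \<in> vertices p \<Longrightarrow>
     adjacent (f u) (f v) \<longleftrightarrow> adjacent u v"
  by (simp add: tree_auts_def)

lemma tree_auts_inv:
  assumes "f \<in> tree_auts p"
  shows "(\<lambda>u\<in>vertices p. inv_into (vertices p) f u) \<in> tree_auts p"
proof -
  let ?V = "vertices p"
  let ?g = "\<lambda>u\<in>?V. inv_into ?V f u"
  have f: "f \<in> Bij ?V" "f ` ?V = ?V" "f [] = []"
    and adj: "\<And>u v. u \<in> ?V \<Longrightarrow> v \<in> ?V \<Longrightarrow> adjacent (f u) (f v) \<longleftrightarrow> adjacent u v"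
    using assms by (auto simp: tree_auts_def Bij_def bij_betw_def)
  have g: "?g \<in> Bij ?V" using f(1) by (rule restrict_inv_into_Bij)
  have gV: "?g u \<in> ?V" "f (?g u) = u" if "u \<in> ?V" for u
    using that f(2) by (auto simp: inv_into_into f_inv_into_f)
  have "?g [] = []"
    using tree_auts_inj[OF assms, of "?g []" "[]"] gV[of "[]"] f(3) by simp
  moreover have "adjacent (?g u) (?g v) \<longleftrightarrow> adjacent u v" if "u \<in> ?V" "v \<in> ?V" for u v
    using adj[OF gV(1)[OF that(1)] gV(1)[OF that(2)]] gV(2) that by metis
  ultimately show ?thesis using g by (simp add: tree_auts_def)
qed

lemma group_AutT: "group (AutT p)"
proof (rule groupI)
  let ?V = "vertices p"
  fix f g assume "f \<in> carrier (AutT p)" "g \<in> carrier (AutT p)"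
  then have fg: "f \<in> tree_auts p" "g \<in> tree_auts p" by (simp_all add: AutT_def)
  have "compose ?V g f \<in> Bij ?V"
    using fg by (intro compose_Bij) (auto simp: tree_auts_def)
  moreover have "adjacent (compose ?V g f u) (compose ?V g f v) \<longleftrightarrow> adjacent u v"
    if "u \<in> ?V" "v \<in> ?V" for u v
    using fg that tree_auts_closed[OF fg(1)] by (simp add: compose_eq tree_auts_def)
  ultimately show "f \<otimes>\<^bsub>AutT p\<^esub> g \<in> carrier (AutT p)"
    using fg by (auto simp: AutT_def tree_auts_def compose_eq)
next
  show "\<one>\<^bsub>AutT p\<^esub> \<in> carrier (AutT p)"
    by (auto simp: AutT_def tree_auts_def id_Bij)
next
  fix f g h
  assume "f \<in> carrier (AutT p)" "g \<in> carrier (AutT p)" "h \<in> carrier (AutT p)"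
  then show "f \<otimes>\<^bsub>AutT p\<^esub> g \<otimes>\<^bsub>AutT p\<^esub> h = f \<otimes>\<^bsub>AutT p\<^esub> (g \<otimes>\<^bsub>AutT p\<^esub> h)"
    by (auto simp: AutT_def compose_def fun_eq_iff tree_auts_closed)
next
  fix f assume "f \<in> carrier (AutT p)"
  then have f: "f \<in> tree_auts p" by (simp add: AutT_def)
  then have ext: "f \<in> extensional (vertices p)" by (simp add: tree_auts_def Bij_def)
  then show "\<one>\<^bsub>AutT p\<^esub> \<otimes>\<^bsub>AutT p\<^esub> f = f"
    by (auto simp: AutT_def compose_def fun_eq_iff extensional_def)
  let ?h = "\<lambda>u\<in>vertices p. inv_into (vertices p) f u"
  have "f ` vertices p = vertices p"
    using f by (auto simp: tree_auts_def Bij_def bij_betw_def)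
  then have "?h \<otimes>\<^bsub>AutT p\<^esub> f = \<one>\<^bsub>AutT p\<^esub>"
    by (auto simp: AutT_def compose_def fun_eq_iff f_inv_into_f)
  then show "\<exists>h\<in>carrier (AutT p). h \<otimes>\<^bsub>AutT p\<^esub> f = \<one>\<^bsub>AutT p\<^esub>"
    using tree_auts_inv[OF f] by (auto simp: AutT_def)
qed

lemma tree_auts_snoc:
  assumes f: "f \<in> tree_auts p" and "u @ [x] \<in> vertices p"
  shows "\<exists>y. f (u @ [x]) = f u @ [y]"
  using assms(2)
proof (induction u arbitrary: x rule: rev_induct)
  case Nil
  have "adjacent (f []) (f [x]) \<longleftrightarrow> adjacent [] [x]"
    using tree_auts_adjacent[OF f, of "[]" "[x]"] Nil by simp
  then have "adjacent (f []) (f [x])" by (simp add: adjacent_def)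
  moreover have "f [] = []" using f by (simp add: tree_auts_def)
  ultimately show ?case by (auto simp: adjacent_def)
next
  case (snoc z u)
  obtain y where y: "f (u @ [z]) = f u @ [y]" using snoc by auto
  have "adjacent (f (u @ [z])) (f ((u @ [z]) @ [x]))"
  proof -
    have "adjacent (f (u @ [z])) (f ((u @ [z]) @ [x])) \<longleftrightarrow> adjacent (u @ [z]) ((u @ [z]) @ [x])"
      using tree_auts_adjacent[OF f, of "u @ [z]" "(u @ [z]) @ [x]"] snoc.prems by simp
    then show ?thesis by (simp add: adjacent_def)
  qed
  then consider w where "f ((u @ [z]) @ [x]) = f (u @ [z]) @ [w]"
    | w where "f (u @ [z]) = f ((u @ [z]) @ [x]) @ [w]"
    by (auto simp: adjacent_def)
  then show ?case
  proof cases
    case 2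
    then have "f u = f (u @ [z, x])" using y by simp
    then show ?thesis
      using tree_auts_inj[OF f, of u "u @ [z, x]"] snoc.prems by simp
  qed auto
qed

lemma tree_auts_length: "f \<in> tree_auts p \<Longrightarrow> u \<in> vertices p \<Longrightarrow> length (f u) = length u"
proof (induction u rule: rev_induct)
  case (snoc x u)
  then show ?case using tree_auts_snoc[of f p u x] by auto
qed (simp add: tree_auts_def)

theorem section_at_spec:
  assumes g: "g \<in> tree_auts p" and u: "u \<in> vertices p" and v: "v \<in> vertices p"
  shows "g (u @ v) = g u @ section_at p u g v"
proof -
  have "\<exists>w. g (u @ v) = g u @ w" using v
  proof (induction v rule: rev_induct)
    case (snoc x v)
    then show ?case using tree_auts_snoc[OF g, of "u @ v" x] u by auto
  qed simp
  then show ?thesis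
    using tree_auts_length[OF g u] v by (auto simp: section_at_def)
qed

theorem section_at_unique:
  assumes "g \<in> tree_auts p" "u \<in> vertices p" "h \<in> tree_auts p"
    and "\<And>v. v \<in> vertices p \<Longrightarrow> g (u @ v) = g u @ h v"
  shows "h = section_at p u g"
proof
  fix v show "h v = section_at p u g v"
    using assms section_at_spec[of g p u v]
    by (cases "v \<in> vertices p") (auto simp: section_at_def tree_auts_def Bij_def extensional_def)
qed

theorem section_at_closed:
  assumes g: "g \<in> tree_auts p" and u: "u \<in> vertices p"
  shows "section_at p u g \<in> tree_auts p"
proof -
  let ?V = "vertices p" and ?s = "section_at p u g"
  note spec = section_at_spec[OF g u]
  have sV: "?s v \<in> ?V" if "v \<in> ?V" for v
    using spec[OF that] tree_auts_closed[OF g, of "u @ v"] u that by simp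
  have "inj_on ?s ?V"
  proof (rule inj_onI)
    fix v w assume vw: "v \<in> ?V" "w \<in> ?V" "?s v = ?s w"
    then have "g (u @ v) = g (u @ w)" by (simp add: spec)
    then show "v = w" using tree_auts_inj[OF g, of "u @ v" "u @ w"] u vw by simp
  qed
  moreover have "?s ` ?V = ?V"
  proof
    show "?V \<subseteq> ?s ` ?V"
    proof
      fix w assume w: "w \<in> ?V"
      then have "g u @ w \<in> g ` ?V"
        using g tree_auts_closed[OF g u] by (auto simp: tree_auts_def Bij_def bij_betw_def)
      then obtain z where z: "z \<in> ?V" "g z = g u @ w" by auto
      let ?z1 = "take (length u) z" and ?z2 = "drop (length u) z"
      have zV: "?z1 \<in> ?V" "?z2 \<in> ?V"
        using z(1) vertices_simps(3)[of ?z1 ?z2 p] by auto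
      have len: "length z = length u + length w"
        using tree_auts_length[OF g z(1)] tree_auts_length[OF g u] z(2) by simp
      have e: "g ?z1 @ section_at p ?z1 g ?z2 = g u @ w"
        using section_at_spec[OF g zV] z(2) by simp
      moreover have "length (g ?z1) = length (g u)"
        using tree_auts_length[OF g zV(1)] tree_auts_length[OF g u] len by simp
      ultimately have "g ?z1 = g u" by simp
      then have "?z1 = u" using tree_auts_inj[OF g zV(1) u] by simp
      then have "?s ?z2 = w" using e by simp
      then show "w \<in> ?s ` ?V" using zV(2) by blast
    qed
  qed (use sV in auto)
  ultimately have "?s \<in> Bij ?V" by (simp add: Bij_def bij_betw_def section_at_def)
  moreover have "?s [] = []" using spec[of "[]"] by simp
  moreover have "adjacent (?s v) (?s w) \<longleftrightarrow> adjacent v w" if vw: "v \<in> ?V" "w \<in> ?V" for v w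
  proof -
    have pre: "adjacent (y @ v) (y @ w) \<longleftrightarrow> adjacent v w" for y v w :: "nat list"
      by (simp add: adjacent_def)
    have "adjacent (?s v) (?s w) \<longleftrightarrow> adjacent (g (u @ v)) (g (u @ w))"
      by (simp add: spec vw pre)
    also have "\<dots> \<longleftrightarrow> adjacent (u @ v) (u @ w)"
      using g u vw by (simp add: tree_auts_def)
    finally show ?thesis by (simp add: pre)
  qed
  ultimately show ?thesis by (simp add: tree_auts_def)
qed

lemma adjacent_Nil:
  "adjacent [] w \<longleftrightarrow> length w = 1" "adjacent w [] \<longleftrightarrow> length w = 1"
  by (auto simp: adjacent_def length_Suc_conv)

lemma adjacent_Cons: "adjacent (x # w) (y # z) \<longleftrightarrow> x = y \<and> adjacent w z"
  by (auto simp: adjacent_def)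

lemma bij_betw_cycle: "bij_betw (\<lambda>x::nat. x mod p + 1) {1..p} {1..p}"
proof -
  have m: "x mod p = (if x = p then 0 else x)" if "x \<in> {1..p}" for x :: nat
    using that by auto
  have "inj_on (\<lambda>x::nat. x mod p + 1) {1..p}"
    by (rule inj_onI) (auto simp: m split: if_splits)
  moreover have "(\<lambda>x::nat. x mod p + 1) ` {1..p} \<subseteq> {1..p}"
    by (auto simp: Suc_le_eq)
  ultimately show ?thesis
    by (simp add: bij_betw_def card_subset_eq card_image)
qed

theorem ggs_a_tree_auts: "ggs_a p \<in> tree_auts p"
proof -
  let ?V = "vertices p" and ?f = "ggs_a p" and ?c = "\<lambda>x. x mod p + 1"
  have Nil: "?f [] = []" by (simp add: ggs_a_def)
  have Cons: "?f (x # v) = ?c x # v" if "x \<in> {1..p}" "v \<in> ?V" for x v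
    using that by (simp add: ggs_a_def)
  have cV: "?c x \<in> {1..p}" if "x \<in> {1..p}" for x
    using bij_betwE[OF bij_betw_cycle] that by blast
  have ci: "?c x = ?c y \<longleftrightarrow> x = y" if "x \<in> {1..p}" "y \<in> {1..p}" for x y
    using inj_on_eq_iff[OF bij_betw_imp_inj_on[OF bij_betw_cycle] that] .
  have closed: "?f u \<in> ?V" "length (?f u) = length u" if "u \<in> ?V" for u
    using that cV by (cases u; simp add: Nil Cons del: atLeastAtMost_iff)+
  have inj: "u = v" if "u \<in> ?V" "v \<in> ?V" "?f u = ?f v" for u v
    using that ci by (cases u; cases v; simp add: Nil Cons del: atLeastAtMost_iff)
  have surj: "w \<in> ?f ` ?V" if w: "w \<in> ?V" for w
  proof (cases w)
    case Nil
    then show ?thesis using \<open>?f [] = []\<close> by (intro image_eqI[of _ _ "[]"]) auto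
  next
    case w': (Cons y v)
    then have "y \<in> ?c ` {1..p}"
      using w bij_betw_imp_surj_on[OF bij_betw_cycle[of p]] by simp
    then obtain x where "x \<in> {1..p}" "y = ?c x" by blast
    then show ?thesis using w w' Cons by (intro image_eqI[of _ _ "x # v"]) auto
  qed
  have adj: "adjacent (?f u) (?f v) \<longleftrightarrow> adjacent u v" if "u \<in> ?V" "v \<in> ?V" for u v
  proof (cases "u = [] \<or> v = []")
    case True
    then show ?thesis using closed that by (auto simp: adjacent_Nil Nil)
  next
    case False
    then show ?thesis using that ci
      by (cases u; cases v; simp add: Cons adjacent_Cons del: atLeastAtMost_iff)
  qed
  have "?f ` ?V = ?V" using closed(1) surj by blast
  moreover have "inj_on ?f ?V" using inj by (rule inj_onI)
  moreover have "?f \<in> extensional ?V" by (simp add: ggs_a_def)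
  ultimately have "?f \<in> Bij ?V" by (simp add: Bij_def bij_betw_def)
  then show ?thesis using Nil adj by (simp add: tree_auts_def)
qed

lemma ggs_a_pow_tree_auts: "ggs_a p [^]\<^bsub>AutT p\<^esub> (k::int) \<in> tree_auts p"
  using group.int_pow_closed[OF group_AutT, of "ggs_a p" p k] ggs_a_tree_auts
  by (simp add: AutT_def)

lemma ggs_b_Cons:
  assumes "x \<in> {1..p}" "v \<in> vertices p"
  shows "ggs_b p e (x # v) = x # (if x = p then ggs_b p e else ggs_a p [^]\<^bsub>AutT p\<^esub> e x) v"
  using assms by (simp add: ggs_b_def)

theorem ggs_b_tree_auts: "ggs_b p e \<in> tree_auts p"
proof -
  let ?V = "vertices p" and ?f = "ggs_b p e" and ?a = "\<lambda>x. ggs_a p [^]\<^bsub>AutT p\<^esub> e x"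
  note a = ggs_a_pow_tree_auts
  have nil: "?f [] = []" by (simp add: ggs_b_def)
  have closed: "?f u \<in> ?V \<and> length (?f u) = length u" if "u \<in> ?V" for u using that
  proof (induction u)
    case (Cons x u)
    then have x: "x \<in> {1..p}" and u: "u \<in> ?V" by simp_all
    show ?case
      using Cons.IH[OF u] tree_auts_closed[OF a u] tree_auts_length[OF a u] x
      by (simp add: ggs_b_Cons[OF x u] del: atLeastAtMost_iff)
  qed (simp add: nil)
  have inj: "u = v" if "u \<in> ?V" "v \<in> ?V" "?f u = ?f v" for u v using that
  proof (induction u arbitrary: v)
    case Nil
    then show ?case using closed[of v] nil by simp
  next
    case (Cons x u)
    have "length v = Suc (length u)"
      using closed[OF Cons.prems(1)] closed[OF Cons.prems(2)] Cons.prems(3) by simp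
    then obtain y v' where v: "v = y # v'" by (cases v) auto
    have *: "x \<in> {1..p}" "u \<in> ?V" "y \<in> {1..p}" "v' \<in> ?V"
      using Cons.prems v by simp_all
    have "x = y" "(if x = p then ?f else ?a x) u = (if x = p then ?f else ?a x) v'"
      using Cons.prems(3) * by (auto simp: v ggs_b_Cons simp del: atLeastAtMost_iff split: if_splits)
    then show ?case
      using Cons.IH[OF *(2,4)] tree_auts_inj[OF a *(2,4)] v by (simp split: if_splits)
  qed
  have surj: "\<exists>u\<in>?V. ?f u = w" if "w \<in> ?V" for w using that
  proof (induction w)
    case Nil
    then show ?case using nil by (intro bexI[of _ "[]"]) auto
  next
    case (Cons x w)
    then have w: "w \<in> ?V" by simp
    have "\<exists>u\<in>?V. (if x = p then ?f else ?a x) u = w"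
    proof (cases "x = p")
      case True
      then show ?thesis using Cons.IH[OF w] by simp
    next
      case False
      have "w \<in> ?a x ` ?V" using tree_auts_surj[OF a] w by simp
      then show ?thesis using False by auto
    qed
    then obtain u where "u \<in> ?V" "(if x = p then ?f else ?a x) u = w" by blast
    then show ?case using Cons.prems by (intro bexI[of _ "x # u"]) (auto simp: ggs_b_Cons)
  qed
  have adj: "adjacent (?f u) (?f v) \<longleftrightarrow> adjacent u v" if "u \<in> ?V" "v \<in> ?V" for u v using that
  proof (induction u arbitrary: v)
case Nil
    then show ?case using closed[of v] by (simp add: nil adjacent_Nil)
  next
    case (Cons x u)
    show ?case
    proof (cases v)
      case Nil
      then show ?thesis using closed[of "x # u"] Cons.prems by (simp add: nil adjacent_Nil)
    next
      case v: (Cons y v')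
      have *: "x \<in> {1..p}" "u \<in> ?V" "y \<in> {1..p}" "v' \<in> ?V"
        using Cons.prems v by simp_all
      show ?thesis
        using Cons.IH[OF *(2,4)] tree_auts_adjacent[OF a *(2,4)] *
        by (auto simp: v ggs_b_Cons adjacent_Cons simp del: atLeastAtMost_iff)
    qed
  qed
  have "?f ` ?V = ?V" using closed surj by blast
  moreover have "inj_on ?f ?V" using inj by (auto intro: inj_onI)
  moreover have "?f \<in> extensional ?V" by (simp add: ggs_b_def)
  ultimately have "?f \<in> Bij ?V" by (simp add: Bij_def bij_betw_def)
  then show ?thesis using nil adj by (simp add: tree_auts_def)
qed

theorem section_ggs_b:
  assumes "x \<in> {1..p}"
  shows "section_at p [x] (ggs_b p e) = (if x = p then ggs_b p e else ggs_a p [^]\<^bsub>AutT p\<^esub> e x)"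
proof (rule section_at_unique[symmetric])
  show "(if x = p then ggs_b p e else ggs_a p [^]\<^bsub>AutT p\<^esub> e x) \<in> tree_auts p"
    by (simp add: ggs_b_tree_auts ggs_a_pow_tree_auts)
  have "ggs_b p e [x] = [x]"
    using ggs_b_Cons[OF assms, of "[]" e] ggs_a_pow_tree_auts[of p "e x"]
    by (auto simp: tree_auts_def ggs_b_def)
  then show "ggs_b p e ([x] @ v) = ggs_b p e [x] @ (if x = p then ggs_b p e else ggs_a p [^]\<^bsub>AutT p\<^esub> e x) v"
    if "v \<in> vertices p" for v
    using ggs_b_Cons[OF assms that, of e] by simp
qed (use assms ggs_b_tree_auts in auto)

lemma ggs_a_pow_Cons:
  assumes "x < p" "v \<in> vertices p"
  shows "(ggs_a p [^]\<^bsub>AutT p\<^esub> (k::nat)) (Suc x # v) = Suc ((x + k) mod p) # v"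
proof (induction k)
  case 0
  then show ?case using assms by (simp add: AutT_def nat_pow_def)
next
  case (Suc k)
  have "ggs_a p [^]\<^bsub>AutT p\<^esub> Suc k
      = ggs_a p [^]\<^bsub>AutT p\<^esub> k \<otimes>\<^bsub>AutT p\<^esub> ggs_a p"
    by (simp add: nat_pow_def)
  with Suc assms show ?case
    by (simp add: AutT_def compose_def ggs_a_def Suc_le_eq mod_Suc_eq)
qed

lemma ggs_a_pow_p: "ggs_a p [^]\<^bsub>AutT p\<^esub> p = \<one>\<^bsub>AutT p\<^esub>"
proof
  fix u
  have T: "ggs_a p [^]\<^bsub>AutT p\<^esub> p \<in> tree_auts p"
    using ggs_a_pow_tree_auts[of p "int p"] by (simp add: int_pow_int)
  show "(ggs_a p [^]\<^bsub>AutT p\<^esub> p) u = \<one>\<^bsub>AutT p\<^esub> u"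
  proof (cases "u \<in> vertices p")
    case True
    then show ?thesis
    proof (cases u)
      case Nil
      then show ?thesis using T by (simp add: tree_auts_def AutT_def)
    next
      case (Cons x v)
      then obtain y where "x = Suc y" "y < p" using True by (cases x) auto
      then show ?thesis
        using True Cons ggs_a_pow_Cons[of y p v p] by (simp add: AutT_def)
    qed
  qed (use T in \<open>auto simp: AutT_def tree_auts_def Bij_def extensional_def\<close>)
qed

theorem ggs_b_cong:
  assumes "\<And>i. i \<in> {1..p-1} \<Longrightarrow> [e i = e' i] (mod int p)"
  shows "ggs_b p e = ggs_b p e'"
proof -
  interpret group "AutT p" by (rule group_AutT)
  have a: "ggs_a p \<in> carrier (AutT p)" using ggs_a_tree_auts by (simp add: AutT_def)
  have pow: "ggs_a p [^]\<^bsub>AutT p\<^esub> k = ggs_a p [^]\<^bsub>AutT p\<^esub> l" if kl: "[k = l] (mod int p)" for k l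
  proof -
    obtain m where m: "k = l + int p * m"
      using kl by (metis cong_iff_lin cong_sym)
    have "ggs_a p [^]\<^bsub>AutT p\<^esub> (int p * m) = \<one>\<^bsub>AutT p\<^esub>"
      using int_pow_pow[OF a, of "int p" m] ggs_a_pow_p by (simp add: int_pow_int)
    then show ?thesis using a by (simp add: m int_pow_mult)
  qed
  have "ggs_b_fun p e u = ggs_b_fun p e' u" if "u \<in> vertices p" for u using that
  proof (induction u)
    case (Cons x u)
    then show ?case using pow[OF assms, of x] by auto
  qed simp
  then show ?thesis by (auto simp: ggs_b_def)
qed

end

theory Submission
  imports Defs
begin

text \<open>
  The key observation is that \<open>p\<close>-th powers go two levels down: if \<open>e 1 + \<dots> + e (p - 1) \<equiv> 0\<close>, then
  \<open>t\<^sup>p\<close> fixes the second level for every \<open>t\<close> in \<open>G\<close> (\<open>GGS_pow_p_fixes_level2\<close>). Indeed \<open>G\<close> acts on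
  the first level through powers of the cycle, so \<open>t\<close> moves \<open>xy\<close> to \<open>(x + c)(y + m x)\<close> modulo \<open>p\<close>.
  The total shift \<open>\<Sum>\<^sub>x m x\<close> is a homomorphism to the integers modulo \<open>p\<close>; it vanishes on \<open>a\<close>, whose
  sections are trivial, and on \<open>b\<close>, by the hypothesis on \<open>e\<close>. The power \<open>t\<^sup>p\<close> shifts \<open>y\<close> by
  \<open>m x + m (x + c) + m (x + 2c) + \<dots>\<close>, which modulo \<open>p\<close> is \<open>p\<close> times \<open>m x\<close> when \<open>c \<equiv> 0\<close> and the total shift
  otherwise. Applying this to all sections at level \<open>n\<close>, one sees that the \<open>p\<close>-th power of an element
  of the stabilizer of level \<open>n\<close> stabilizes level \<open>n + 2\<close> (\<open>pow_p_level_stabilizer\<close>).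

  On the other hand some \<open>p\<close>-th powers have a nontrivial section: \<open>(ab)\<^sup>p\<close> has section
  \<open>a^(e 1) \<dots> a^(e (p - 1)) b = b\<close> at the letter \<open>p\<close>, and after conjugation by a power of \<open>a\<close> the same
  happens at any prescribed letter (\<open>ggs_b_section_of_pow_p\<close>).

  Write \<open>\<psi>\<^sub>u\<close> for the section map and \<open>st\<^sub>n\<close> for the stabilizer of level \<open>n\<close> in \<open>G\<close>. By induction on
  \<open>n\<close>, for every \<open>u\<close> of length \<open>n\<close> both \<open>\<psi>\<^sub>u(st\<^sub>n) = G\<close> and \<open>b \<in> \<psi>\<^sub>u(st\<^sub>n\<^sub>+\<^sub>1)\<close>
  (\<open>GGS_sections_of_stabilizers\<close>). Suppose this for \<open>u\<close> and let \<open>x\<close> be a letter. Since \<open>st\<^sub>n\<^sub>+\<^sub>1\<close> is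
  normal, \<open>\<psi>\<^sub>u(st\<^sub>n\<^sub>+\<^sub>1)\<close> contains all conjugates of \<open>b\<close> by powers of \<open>a\<close>. Their sections at \<open>x\<close>
  are \<open>b\<close> and all the \<open>a^(e i)\<close>, one of which generates the same subgroup as \<open>a\<close>; hence
  \<open>\<psi>\<^sub>u\<^sub>x(st\<^sub>n\<^sub>+\<^sub>1) = G\<close>. Finally take \<open>k\<close> in \<open>st\<^sub>n\<close> whose section at \<open>u\<close> is a conjugate of \<open>ab\<close> as
  above: \<open>k\<^sup>p\<close> lies in \<open>st\<^sub>n\<^sub>+\<^sub>2\<close> and its section at \<open>ux\<close> is \<open>b\<close>.
\<close>

section \<open>Sections as a cocycle\<close>

interpretation aut: group "AutT p" for p
  by (rule group_AutT)

lemma carrier_AutT [simp]: "carrier (AutT p) = tree_auts p"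
  by (simp add: AutT_def)

lemma AutT_mult_apply: "u \<in> vertices p \<Longrightarrow> (f \<otimes>\<^bsub>AutT p\<^esub> g) u = g (f u)"
  by (simp add: AutT_def compose_eq)

lemma AutT_one_apply: "u \<in> vertices p \<Longrightarrow> \<one>\<^bsub>AutT p\<^esub> u = u"
  by (simp add: AutT_def)

lemma AutT_inv_apply:
  assumes "f \<in> tree_auts p" "u \<in> vertices p"
  shows "f ((inv\<^bsub>AutT p\<^esub> f) u) = u" "(inv\<^bsub>AutT p\<^esub> f) (f u) = u"
  using assms aut.l_inv[of f p] aut.r_inv[of f p]
    AutT_mult_apply[of u p f "inv\<^bsub>AutT p\<^esub> f"] AutT_mult_apply[of u p "inv\<^bsub>AutT p\<^esub> f" f]
    AutT_one_apply[of u p]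
  by simp_all

lemma tree_auts_level: "g \<in> tree_auts p \<Longrightarrow> u \<in> level p n \<Longrightarrow> g u \<in> level p n"
  by (simp add: level_def tree_auts_closed tree_auts_length)

lemma section_at_append:
  "u \<in> vertices p \<Longrightarrow> v \<in> vertices p \<Longrightarrow> section_at p (u @ v) g = section_at p v (section_at p u g)"
  by (auto simp: section_at_def fun_eq_iff add.commute)

lemma section_at_one: "u \<in> vertices p \<Longrightarrow> section_at p u \<one>\<^bsub>AutT p\<^esub> = \<one>\<^bsub>AutT p\<^esub>"
  by (auto simp: section_at_def AutT_def fun_eq_iff)

lemma section_at_mult:
  assumes f: "f \<in> tree_auts p" and g: "g \<in> tree_auts p" and u: "u \<in> vertices p"
  shows "section_at p u (f \<otimes>\<^bsub>AutT p\<^esub> g) = section_at p u f \<otimes>\<^bsub>AutT p\<^esub> section_at p (f u) g"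
proof
  fix v
  show "section_at p u (f \<otimes>\<^bsub>AutT p\<^esub> g) v = (section_at p u f \<otimes>\<^bsub>AutT p\<^esub> section_at p (f u) g) v"
  proof (cases "v \<in> vertices p")
    case True
    note fu = tree_auts_closed[OF f u] tree_auts_length[OF f u]
    have sv: "section_at p u f v \<in> vertices p"
      using tree_auts_closed[OF section_at_closed[OF f u] True] .
    have "section_at p u (f \<otimes>\<^bsub>AutT p\<^esub> g) v = drop (length u) (g (f (u @ v)))"
      using True u by (simp add: section_at_def AutT_mult_apply)
    also have "\<dots> = drop (length (f u)) (g (f u @ section_at p u f v))"
      using section_at_spec[OF f u True] fu by simp
    also have "\<dots> = section_at p (f u) g (section_at p u f v)"
      using sv by (simp add: section_at_def)
    finally show ?thesis using True by (simp add: AutT_mult_apply)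
  qed (simp add: section_at_def AutT_def compose_def)
qed

lemma section_at_inv:
  assumes f: "f \<in> tree_auts p" and u: "u \<in> vertices p"
  shows "section_at p (f u) (inv\<^bsub>AutT p\<^esub> f) = inv\<^bsub>AutT p\<^esub> (section_at p u f)"
proof -
  have i: "inv\<^bsub>AutT p\<^esub> f \<in> tree_auts p" using aut.inv_closed[of f p] f by simp
  have "section_at p u f \<otimes>\<^bsub>AutT p\<^esub> section_at p (f u) (inv\<^bsub>AutT p\<^esub> f) = \<one>\<^bsub>AutT p\<^esub>"
    using section_at_mult[OF f i u] aut.r_inv[of f p] f u by (simp add: section_at_one)
  then show ?thesis
    using aut.inv_equality[OF aut.inv_comm]
      section_at_closed[OF f u] section_at_closed[OF i tree_auts_closed[OF f u]] by simp
qed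

text \<open>On the stabilizer of a vertex the cocycle identity \<open>section_at_mult\<close> makes the section map
  multiplicative.\<close>

lemma section_at_pow_fixed:
  assumes f: "f \<in> tree_auts p" and u: "u \<in> vertices p" "f u = u"
  shows "(f [^]\<^bsub>AutT p\<^esub> (k::nat)) u = u"
    and "section_at p u (f [^]\<^bsub>AutT p\<^esub> k) = section_at p u f [^]\<^bsub>AutT p\<^esub> k"
proof -
  have c: "f [^]\<^bsub>AutT p\<^esub> k \<in> tree_auts p" for k :: nat
    using aut.nat_pow_closed[of f p k] f by simp
  have fix_u: "(f [^]\<^bsub>AutT p\<^esub> k) u = u" for k :: nat
    by (induction k) (use u in \<open>simp_all add: AutT_one_apply AutT_mult_apply\<close>)
  then show "(f [^]\<^bsub>AutT p\<^esub> k) u = u" .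
  show "section_at p u (f [^]\<^bsub>AutT p\<^esub> k) = section_at p u f [^]\<^bsub>AutT p\<^esub> k"
    by (induction k) (use u f c fix_u in \<open>simp_all add: section_at_one section_at_mult\<close>)
qed

text \<open>Conjugation transports sections along the orbit: this is what lets a section found at one
  letter be moved to another one.\<close>

lemma section_at_conj:
  assumes f: "f \<in> tree_auts p" and g: "g \<in> tree_auts p" and u: "u \<in> vertices p" "g u = u"
  shows "section_at p (f u) (inv\<^bsub>AutT p\<^esub> f \<otimes>\<^bsub>AutT p\<^esub> g \<otimes>\<^bsub>AutT p\<^esub> f) =
    inv\<^bsub>AutT p\<^esub> (section_at p u f) \<otimes>\<^bsub>AutT p\<^esub> section_at p u g \<otimes>\<^bsub>AutT p\<^esub> section_at p u f"
proof -
  have i: "inv\<^bsub>AutT p\<^esub> f \<in> tree_auts p" using aut.inv_closed[of f p] f by simp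
  have ig: "inv\<^bsub>AutT p\<^esub> f \<otimes>\<^bsub>AutT p\<^esub> g \<in> tree_auts p"
    using aut.m_closed[of "inv\<^bsub>AutT p\<^esub> f" p g] i g by simp
  note fu = tree_auts_closed[OF f u(1)]
  show ?thesis
    using section_at_mult[OF ig f fu] section_at_mult[OF i g fu] section_at_inv[OF f u(1)]
      AutT_mult_apply[OF fu] AutT_inv_apply(2)[OF f u(1)] u(2) by simp
qed

lemma subgroup_level_stabilizer:
  assumes "subgroup H (AutT p)"
  shows "subgroup (level_stabilizer p H n) (AutT p)"
proof -
  interpret H: subgroup H "AutT p" by fact
  have H: "h \<in> tree_auts p" if "h \<in> H" for h using H.subset that by auto
  show ?thesis
  proof (rule aut.subgroupI)
    have "\<one>\<^bsub>AutT p\<^esub> \<in> level_stabilizer p H n"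
      using H.one_closed by (simp add: level_stabilizer_def level_def AutT_one_apply)
    then show "level_stabilizer p H n \<noteq> {}" by blast
    show "level_stabilizer p H n \<subseteq> carrier (AutT p)"
      using H by (auto simp: level_stabilizer_def)
    fix f assume f: "f \<in> level_stabilizer p H n"
    then have fH: "f \<in> H" and fu: "\<And>u. u \<in> level p n \<Longrightarrow> f u = u"
      by (simp_all add: level_stabilizer_def)
    have "(inv\<^bsub>AutT p\<^esub> f) u = u" if u: "u \<in> level p n" for u
      using AutT_inv_apply(2)[OF H[OF fH], of u] fu[OF u] u by (simp add: level_def)
    then show "inv\<^bsub>AutT p\<^esub> f \<in> level_stabilizer p H n"
      using fH by (simp add: level_stabilizer_def)
    fix g assume "g \<in> level_stabilizer p H n"
    then show "f \<otimes>\<^bsub>AutT p\<^esub> g \<in> level_stabilizer p H n"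
      using fH fu by (simp add: level_stabilizer_def level_def AutT_mult_apply)
  qed
qed

lemma level_stabilizer_conj:
  assumes H: "subgroup H (AutT p)" and f: "f \<in> H" and g: "g \<in> level_stabilizer p H n"
  shows "inv\<^bsub>AutT p\<^esub> f \<otimes>\<^bsub>AutT p\<^esub> g \<otimes>\<^bsub>AutT p\<^esub> f \<in> level_stabilizer p H n"
proof -
  interpret H: subgroup H "AutT p" by fact
  have gH: "g \<in> H" using g by (simp add: level_stabilizer_def)
  have ft: "f \<in> tree_auts p" "inv\<^bsub>AutT p\<^esub> f \<in> tree_auts p"
    using H.subset f H.m_inv_closed by auto
  have "(inv\<^bsub>AutT p\<^esub> f \<otimes>\<^bsub>AutT p\<^esub> g \<otimes>\<^bsub>AutT p\<^esub> f) u = u" if u: "u \<in> level p n" for u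
    using g tree_auts_level[OF ft(2) u] u AutT_inv_apply(1)[OF ft(1)]
    by (simp add: AutT_mult_apply level_stabilizer_def level_def)
  then show ?thesis using f gH by (simp add: level_stabilizer_def)
qed

lemma subgroup_section_image:
  assumes H: "subgroup H (AutT p)" and u: "u \<in> level p n"
  shows "subgroup (section_at p u ` level_stabilizer p H n) (AutT p)"
proof -
  let ?S = "level_stabilizer p H n"
  interpret S: subgroup ?S "AutT p" by (rule subgroup_level_stabilizer[OF H])
  have S: "h \<in> tree_auts p" "h u = u" if "h \<in> ?S" for h
    using S.subset that u by (auto simp: level_stabilizer_def)
  have uV: "u \<in> vertices p" using u by (simp add: level_def)
  show ?thesis
  proof (rule aut.subgroupI)
    show "section_at p u ` ?S \<subseteq> carrier (AutT p)"
      using S section_at_closed[OF _ uV] by auto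
    show "section_at p u ` ?S \<noteq> {}" using S.one_closed by blast
    show "inv\<^bsub>AutT p\<^esub> g \<in> section_at p u ` ?S" if g: "g \<in> section_at p u ` ?S" for g
    proof -
      obtain h where h: "h \<in> ?S" "g = section_at p u h" using g by blast
      then have "inv\<^bsub>AutT p\<^esub> g = section_at p u (inv\<^bsub>AutT p\<^esub> h)"
        using section_at_inv[OF S(1)[OF h(1)] uV] S(2)[OF h(1)] by simp
      then show ?thesis using S.m_inv_closed[OF h(1)] by blast
    qed
    show "f \<otimes>\<^bsub>AutT p\<^esub> g \<in> section_at p u ` ?S"
      if fg: "f \<in> section_at p u ` ?S" "g \<in> section_at p u ` ?S" for f g
    proof -
      obtain f' g' where h: "f' \<in> ?S" "f = section_at p u f'" "g' \<in> ?S" "g = section_at p u g'"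
        using fg by blast
      then have "f \<otimes>\<^bsub>AutT p\<^esub> g = section_at p u (f' \<otimes>\<^bsub>AutT p\<^esub> g')"
        using section_at_mult[OF S(1)[OF h(1)] S(1)[OF h(3)] uV] S(2)[OF h(1)] by simp
      then show ?thesis using S.m_closed[OF h(1,3)] by blast
    qed
  qed
qed


section \<open>Powers of the rooted generator\<close>

lemma ggs_a_pow_cong:
  assumes "[k = l] (mod int p)"
  shows "ggs_a p [^]\<^bsub>AutT p\<^esub> k = ggs_a p [^]\<^bsub>AutT p\<^esub> l"
proof -
  obtain m where m: "k = l + int p * m"
    using assms by (metis cong_iff_lin cong_sym)
  have "ggs_a p [^]\<^bsub>AutT p\<^esub> (int p * m) = \<one>\<^bsub>AutT p\<^esub>"
    using aut.int_pow_pow[of "ggs_a p" p "int p" m] ggs_a_pow_p ggs_a_tree_auts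
    by (simp add: int_pow_int)
  then show ?thesis using ggs_a_tree_auts[of p] ggs_a_pow_tree_auts[of p l]
    by (simp add: m aut.int_pow_mult)
qed

text \<open>Letters are compared modulo \<open>p\<close>, so that neither the shift by one in \<^const>\<open>ggs_a\<close> nor the
  sign of the exponent needs a case distinction.\<close>

lemma ggs_a_int_pow_Cons:
  assumes "x \<in> {1..p}" "v \<in> vertices p"
  shows "\<exists>y\<in>{1..p}. [int y = int x + k] (mod int p) \<and> (ggs_a p [^]\<^bsub>AutT p\<^esub> (k::int)) (x # v) = y # v"
proof -
  obtain z where z: "x = Suc z" "z < p" using assms by (cases x) auto
  let ?k = "nat (k mod int p)"
  have k: "int ?k = k mod int p" using z by simp
  have "[k = int ?k] (mod int p)" using k by (simp only: cong_def mod_mod_trivial)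
  then have "ggs_a p [^]\<^bsub>AutT p\<^esub> k = ggs_a p [^]\<^bsub>AutT p\<^esub> ?k"
    using ggs_a_pow_cong int_pow_int by metis
  moreover have "[int (Suc ((z + ?k) mod p)) = int x + k] (mod int p)"
    using k by (simp add: cong_def z zmod_int mod_simps algebra_simps)
  ultimately show ?thesis
    using ggs_a_pow_Cons[OF z(2) assms(2), of ?k] z
    by (intro bexI[of _ "Suc ((z + ?k) mod p)"]) (auto simp: Suc_le_eq)
qed

lemma section_ggs_a_pow:
  assumes "x \<in> {1..p}"
  shows "section_at p [x] (ggs_a p [^]\<^bsub>AutT p\<^esub> (k::int)) = \<one>\<^bsub>AutT p\<^esub>"
proof
  fix v
  show "section_at p [x] (ggs_a p [^]\<^bsub>AutT p\<^esub> k) v = \<one>\<^bsub>AutT p\<^esub> v"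
    using ggs_a_int_pow_Cons[OF assms, of v k] by (auto simp: section_at_def AutT_def)
qed

lemma letter_eq_of_cong:
  assumes "x \<in> {1..p}" "y \<in> {1..p}" "[int x = int y] (mod int p)"
  shows "x = y"
proof -
  have "[int x - 1 = int y - 1] (mod int p)" using assms(3) by (rule cong_diff) simp
  moreover have "(int x - 1) mod int p = int x - 1" "(int y - 1) mod int p = int y - 1"
    using assms by (auto intro: mod_pos_pos_trivial)
  ultimately show ?thesis by (simp add: cong_def)
qed

lemma ggs_a_pow_transitive:
  assumes "x \<in> {1..p}" "y \<in> {1..p}"
  shows "(ggs_a p [^]\<^bsub>AutT p\<^esub> (int y - int x)) [x] = [y]"
  using ggs_a_int_pow_Cons[OF assms(1), of "[]" "int y - int x"] letter_eq_of_cong[OF _ assms(2)]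
  by auto


section \<open>Generators of a GGS-group and self-similarity\<close>

lemma subgroup_GGS: "subgroup (GGS_group p e) (AutT p)"
  unfolding GGS_group_def
  by (rule aut.generate_is_subgroup) (simp add: ggs_a_tree_auts ggs_b_tree_auts)

lemma GGS_tree_auts: "g \<in> GGS_group p e \<Longrightarrow> g \<in> tree_auts p"
  using subgroup.subset[OF subgroup_GGS[of p e]] by auto

lemma ggs_a_in_GGS: "ggs_a p \<in> GGS_group p e" and ggs_b_in_GGS: "ggs_b p e \<in> GGS_group p e"
  by (auto simp: GGS_group_def intro: generate.incl)

lemma ggs_a_pow_in_GGS: "ggs_a p [^]\<^bsub>AutT p\<^esub> (k::int) \<in> GGS_group p e"
  using aut.subgroup_int_pow_closed[OF subgroup_GGS ggs_a_in_GGS] .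

lemma GGS_subset:
  assumes "subgroup H (AutT p)" "ggs_a p \<in> H" "ggs_b p e \<in> H"
  shows "GGS_group p e \<subseteq> H"
  unfolding GGS_group_def using assms by (intro aut.generate_subgroup_incl) auto

lemma ggs_b_letter: "x \<in> {1..p} \<Longrightarrow> ggs_b p e [x] = [x]"
  using ggs_b_Cons[of x p "[]" e] ggs_a_pow_tree_auts[of p "e x"] ggs_b_tree_auts[of p e]
  by (simp add: tree_auts_def del: atLeastAtMost_iff)

lemma section_ggs_b_in_GGS:
  "x \<in> {1..p} \<Longrightarrow> section_at p [x] (ggs_b p e) \<in> GGS_group p e"
  by (simp add: section_ggs_b ggs_a_pow_in_GGS ggs_b_in_GGS del: atLeastAtMost_iff)

lemma section_ggs_a: "x \<in> {1..p} \<Longrightarrow> section_at p [x] (ggs_a p) = \<one>\<^bsub>AutT p\<^esub>"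
  using section_ggs_a_pow[of x p 1] ggs_a_tree_auts[of p] by (simp add: aut.int_pow_1)

text \<open>By the cocycle identity, the automorphisms all of whose first-level sections lie in a given
  subgroup form a subgroup, so it is enough to look at the two generators.\<close>

lemma section_letter_GGS:
  assumes "g \<in> GGS_group p e" "x \<in> {1..p}"
  shows "section_at p [x] g \<in> GGS_group p e"
proof -
  let ?G = "GGS_group p e"
  interpret G: subgroup ?G "AutT p" by (rule subgroup_GGS)
  let ?H = "{g \<in> tree_auts p. \<forall>x\<in>{1..p}. section_at p [x] g \<in> ?G}"
  have letter: "\<exists>y\<in>{1..p}. g [x] = [y]" if "g \<in> tree_auts p" "x \<in> {1..p}" for g x
    using tree_auts_closed[of g p "[x]"] tree_auts_length[of g p "[x]"] that
    by (auto simp: length_Suc_conv)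
  have "subgroup ?H (AutT p)"
  proof (rule aut.subgroupI)
    have "\<one>\<^bsub>AutT p\<^esub> \<in> ?H"
      using aut.one_closed[of p] by (simp add: section_at_one)
    then show "?H \<noteq> {}" by blast
    fix f assume f: "f \<in> ?H"
    have i: "inv\<^bsub>AutT p\<^esub> f \<in> tree_auts p" using f aut.inv_closed[of f p] by simp
    have "section_at p [x] (inv\<^bsub>AutT p\<^esub> f) \<in> ?G" if x: "x \<in> {1..p}" for x
    proof -
      obtain y where y: "y \<in> {1..p}" "(inv\<^bsub>AutT p\<^esub> f) [x] = [y]" using letter[OF i x] by blast
      then have "f [y] = [x]" using AutT_inv_apply(1)[of f p "[x]"] f x by simp
      then show ?thesis using section_at_inv[of f p "[y]"] f y(1) by auto
    qed
    then show "inv\<^bsub>AutT p\<^esub> f \<in> ?H" using i by simp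
    fix g assume g: "g \<in> ?H"
    have "section_at p [x] (f \<otimes>\<^bsub>AutT p\<^esub> g) \<in> ?G" if x: "x \<in> {1..p}" for x
    proof -
      obtain y where y: "y \<in> {1..p}" "f [x] = [y]" using letter[of f x] f x by blast
      then show ?thesis using section_at_mult[of f p g "[x]"] f g x by auto
    qed
    then show "f \<otimes>\<^bsub>AutT p\<^esub> g \<in> ?H"
      using f g aut.m_closed[of f p g] by simp
  qed auto
  then have "?G \<subseteq> ?H"
    by (rule GGS_subset)
      (auto simp: ggs_a_tree_auts ggs_b_tree_auts section_ggs_a section_ggs_b_in_GGS)
  then show ?thesis using assms by blast
qed

lemma section_GGS:
  "g \<in> GGS_group p e \<Longrightarrow> u \<in> vertices p \<Longrightarrow> section_at p u g \<in> GGS_group p e"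
proof (induction u arbitrary: g)
  case Nil
  have "section_at p [] g = g"
    using GGS_tree_auts[OF Nil(1)]
    by (auto simp: section_at_def tree_auts_def Bij_def extensional_def)
  then show ?case using Nil by simp
next
  case (Cons x u)
  then show ?case
    using section_at_append[of "[x]" p u g] section_letter_GGS[of g p e x] by simp
qed


section \<open>The second level: \<open>p\<close>-th powers act trivially\<close>

text \<open>
  An action on words of length two by translations modulo \<open>p\<close>: the first letter is shifted by \<open>c\<close> and
  the second one by an amount depending on the first. The function \<open>m\<close> is evaluated at residues in
  \<open>{0..<p}\<close>, the letter \<open>p\<close> having residue \<open>0\<close>; in this way shifted arguments can be reduced modulo \<open>p\<close>
  without leaving the index range.
\<close>

definition shifts_level2 :: "nat \<Rightarrow> (nat list \<Rightarrow> nat list) \<Rightarrow> int \<Rightarrow> (int \<Rightarrow> int) \<Rightarrow> bool" where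
  "shifts_level2 p g c m \<longleftrightarrow> (\<forall>x\<in>{1..p}. \<forall>y\<in>{1..p}. \<exists>x'\<in>{1..p}. \<exists>y'\<in>{1..p}. g [x, y] = [x', y'] \<and>
     [int x' = int x + c] (mod int p) \<and> [int y' = int y + m (int x mod int p)] (mod int p))"

lemma shifts_level2_one: "shifts_level2 p \<one>\<^bsub>AutT p\<^esub> 0 (\<lambda>_. 0)"
  by (auto simp: shifts_level2_def AutT_def)

lemma shifts_level2_mult:
  assumes "shifts_level2 p f c m" "shifts_level2 p g d n"
  shows "shifts_level2 p (f \<otimes>\<^bsub>AutT p\<^esub> g) (c + d) (\<lambda>r. m r + n ((r + c) mod int p))"
  unfolding shifts_level2_def
proof (intro ballI)
  fix x y assume xy: "x \<in> {1..p}" "y \<in> {1..p}"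
  obtain x1 y1 where 1: "x1 \<in> {1..p}" "y1 \<in> {1..p}" "f [x, y] = [x1, y1]"
    "[int x1 = int x + c] (mod int p)" "[int y1 = int y + m (int x mod int p)] (mod int p)"
    using assms(1) xy unfolding shifts_level2_def by blast
  obtain x2 y2 where 2: "x2 \<in> {1..p}" "y2 \<in> {1..p}" "g [x1, y1] = [x2, y2]"
    "[int x2 = int x1 + d] (mod int p)" "[int y2 = int y1 + n (int x1 mod int p)] (mod int p)"
    using assms(2) 1(1,2) unfolding shifts_level2_def by blast
  have "(f \<otimes>\<^bsub>AutT p\<^esub> g) [x, y] = [x2, y2]" using xy 1(3) 2(3) by (simp add: AutT_mult_apply)
  moreover have "[int x2 = int x + (c + d)] (mod int p)"
    using cong_trans[OF 2(4) cong_add[OF 1(4) cong_refl[of d]]] by (simp add: add.assoc)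
  moreover have "int x1 mod int p = (int x mod int p + c) mod int p"
    using 1(4) by (simp add: cong_def mod_simps)
  then have "[int y2 = int y + (m (int x mod int p) + n ((int x mod int p + c) mod int p))] (mod int p)"
    using cong_trans[OF 2(5) cong_add[OF 1(5) cong_refl[of "n (int x1 mod int p)"]]]
    by (simp add: add.assoc)
  ultimately show "\<exists>x'\<in>{1..p}. \<exists>y'\<in>{1..p}. (f \<otimes>\<^bsub>AutT p\<^esub> g) [x, y] = [x', y'] \<and>
      [int x' = int x + (c + d)] (mod int p) \<and>
      [int y' = int y + (m (int x mod int p) + n ((int x mod int p + c) mod int p))] (mod int p)"
    using 2(1,2) by blast
qed

lemma shifts_level2_inv:
  assumes g: "g \<in> tree_auts p" and s: "shifts_level2 p g c m"
  shows "shifts_level2 p (inv\<^bsub>AutT p\<^esub> g) (- c) (\<lambda>r. - m ((r - c) mod int p))"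
  unfolding shifts_level2_def
proof (intro ballI)
  fix x y assume xy: "x \<in> {1..p}" "y \<in> {1..p}"
  then have V: "[x, y] \<in> vertices p" by simp
  have i: "inv\<^bsub>AutT p\<^esub> g \<in> tree_auts p" using g aut.inv_closed[of g p] by simp
  obtain x1 y1 where 1: "(inv\<^bsub>AutT p\<^esub> g) [x, y] = [x1, y1]" "x1 \<in> {1..p}" "y1 \<in> {1..p}"
    using tree_auts_closed[OF i V] tree_auts_length[OF i V] by (auto simp: length_Suc_conv)
  have "g [x1, y1] = [x, y]" using AutT_inv_apply(1)[OF g V] 1(1) by simp
  then have x: "[int x = int x1 + c] (mod int p)"
    and y: "[int y = int y1 + m (int x1 mod int p)] (mod int p)"
    using s 1(2,3) unfolding shifts_level2_def by fastforce+
  have "[int x1 = int x + - c] (mod int p)"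
    using cong_diff[OF cong_sym[OF x] cong_refl[of c]] by simp
  moreover from this have "int x1 mod int p = (int x mod int p - c) mod int p"
    by (simp add: cong_def mod_simps)
  then have "[int y1 = int y + - m ((int x mod int p - c) mod int p)] (mod int p)"
    using cong_diff[OF cong_sym[OF y] cong_refl[of "m (int x1 mod int p)"]] by simp
  ultimately show "\<exists>x'\<in>{1..p}. \<exists>y'\<in>{1..p}. (inv\<^bsub>AutT p\<^esub> g) [x, y] = [x', y'] \<and>
      [int x' = int x + - c] (mod int p) \<and>
      [int y' = int y + - m ((int x mod int p - c) mod int p)] (mod int p)"
    using 1 by blast
qed

lemma sum_residues_shift:
  fixes m :: "int \<Rightarrow> int"
  shows "(\<Sum>r\<in>{0..<int p}. m ((r + c) mod int p)) = (\<Sum>r\<in>{0..<int p}. m r)"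
proof (rule sum.reindex_bij_witness[where i = "\<lambda>r. (r - c) mod int p" and j = "\<lambda>r. (r + c) mod int p"])
qed (auto simp: mod_simps)

text \<open>Vanishing total shift is preserved by products and inverses, because translating the argument
  permutes the residues (\<open>sum_residues_shift\<close>). It holds for \<open>b\<close> exactly by the hypothesis on \<open>e\<close>.\<close>

lemma GGS_shifts_level2:
  assumes p: "0 < p" and sum0: "[(\<Sum>i=1..p-1. e i) = 0] (mod int p)" and g: "g \<in> GGS_group p e"
  obtains c m where "shifts_level2 p g c m" "[(\<Sum>r\<in>{0..<int p}. m r) = 0] (mod int p)"
proof -
  let ?H = "{g \<in> tree_auts p. \<exists>c m. shifts_level2 p g c m \<and> [(\<Sum>r\<in>{0..<int p}. m r) = 0] (mod int p)}"
  have "subgroup ?H (AutT p)"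
  proof (rule aut.subgroupI)
    have "\<one>\<^bsub>AutT p\<^esub> \<in> ?H"
      using aut.one_closed[of p] shifts_level2_one[of p] by fastforce
    then show "?H \<noteq> {}" by blast
    fix f assume f: "f \<in> ?H"
    then obtain c m where cm: "shifts_level2 p f c m" "[(\<Sum>r\<in>{0..<int p}. m r) = 0] (mod int p)"
      by blast
    have "[(\<Sum>r\<in>{0..<int p}. - m ((r - c) mod int p)) = 0] (mod int p)"
      using cm(2) sum_residues_shift[where c = "- c" and m = m and p = p]
      by (simp add: sum_negf cong_0_iff)
    moreover have "inv\<^bsub>AutT p\<^esub> f \<in> tree_auts p" using f aut.inv_closed[of f p] by simp
    ultimately show "inv\<^bsub>AutT p\<^esub> f \<in> ?H" using shifts_level2_inv[OF _ cm(1)] f by blast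
    fix g assume g: "g \<in> ?H"
    then obtain d n where dn: "shifts_level2 p g d n" "[(\<Sum>r\<in>{0..<int p}. n r) = 0] (mod int p)"
      by blast
    have "[(\<Sum>r\<in>{0..<int p}. m r + n ((r + c) mod int p)) = 0] (mod int p)"
      using cong_add[OF cm(2) dn(2)] by (simp add: sum.distrib sum_residues_shift)
    moreover have "f \<otimes>\<^bsub>AutT p\<^esub> g \<in> tree_auts p" using f g aut.m_closed[of f p g] by simp
    ultimately show "f \<otimes>\<^bsub>AutT p\<^esub> g \<in> ?H" using shifts_level2_mult[OF cm(1) dn(1)] by blast
  qed auto
  moreover have "ggs_a p \<in> ?H"
  proof -
    have "shifts_level2 p (ggs_a p) 1 (\<lambda>_. 0)"
      unfolding shifts_level2_def
    proof (intro ballI)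
      fix x y assume "x \<in> {1..p}" "y \<in> {1..p}"
      then show "\<exists>x'\<in>{1..p}. \<exists>y'\<in>{1..p}. ggs_a p [x, y] = [x', y'] \<and>
          [int x' = int x + 1] (mod int p) \<and> [int y' = int y + 0] (mod int p)"
        using ggs_a_int_pow_Cons[of x p "[y]" 1] ggs_a_tree_auts[of p] by (auto simp: aut.int_pow_1)
    qed
    then show ?thesis using ggs_a_tree_auts[of p] by fastforce
  qed
  moreover have "ggs_b p e \<in> ?H"
  proof -
    \<comment> \<open>Residue \<open>0\<close> is the letter \<open>p\<close>, where the section is \<open>b\<close> itself and so fixes the first level.\<close>
    let ?m = "\<lambda>r::int. if r = 0 then 0 else e (nat r)"
    have "shifts_level2 p (ggs_b p e) 0 ?m"
      unfolding shifts_level2_def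
    proof (intro ballI)
      fix x y assume xy: "x \<in> {1..p}" "y \<in> {1..p}"
      show "\<exists>x'\<in>{1..p}. \<exists>y'\<in>{1..p}. ggs_b p e [x, y] = [x', y'] \<and>
          [int x' = int x + 0] (mod int p) \<and> [int y' = int y + ?m (int x mod int p)] (mod int p)"
      proof (cases "x = p")
        case True
        then have "ggs_b p e [x, y] = [x, y]"
          using ggs_b_Cons[of x p "[y]" e] ggs_b_letter[OF xy(2)] xy by simp
        then show ?thesis using True xy by auto
      next
        case False
        then have "?m (int x mod int p) = e x" using xy by simp
        moreover obtain y' where "y' \<in> {1..p}" "[int y' = int y + e x] (mod int p)"
          "(ggs_a p [^]\<^bsub>AutT p\<^esub> e x) [y] = [y']"
          using ggs_a_int_pow_Cons[OF xy(2), of "[]" "e x"] by auto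
        moreover have "ggs_b p e [x, y] = x # (ggs_a p [^]\<^bsub>AutT p\<^esub> e x) [y]"
          using ggs_b_Cons[of x p "[y]" e] False xy by simp
        ultimately show ?thesis using xy(1) by auto
      qed
    qed
    moreover have "(\<Sum>r\<in>{0..<int p}. ?m r) = (\<Sum>i=1..p-1. e i)"
    proof -
      have "(\<Sum>r\<in>{0..<int p}. ?m r) = (\<Sum>r\<in>{1..<int p}. ?m r)"
        using p by (intro sum.mono_neutral_right) auto
      also have "\<dots> = (\<Sum>i=1..p-1. e i)"
        by (rule sum.reindex_bij_witness[where i = int and j = nat]) auto
      finally show ?thesis .
    qed
    ultimately show ?thesis using sum0 ggs_b_tree_auts[of p e] by fastforce
  qed
  ultimately have "GGS_group p e \<subseteq> ?H" by (rule GGS_subset)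
  then show ?thesis using g that by blast
qed

lemma shifts_level2_pow:
  assumes "shifts_level2 p g c m"
  shows "shifts_level2 p (g [^]\<^bsub>AutT p\<^esub> (k::nat)) (int k * c) (\<lambda>r. \<Sum>i<k. m ((r + int i * c) mod int p))"
proof (induction k)
  case 0
  then show ?case by (simp add: shifts_level2_one)
next
  case (Suc k)
  show ?case using shifts_level2_mult[OF Suc assms] by (simp add: algebra_simps)
qed

text \<open>For \<open>c\<close> prime to \<open>p\<close> the progression runs through every residue once; for \<open>c\<close> divisible by \<open>p\<close>
  it is constant and the sum is a multiple of \<open>p\<close>.\<close>

lemma sum_arith_progression_residues:
  fixes m :: "int \<Rightarrow> int"
  assumes p: "prime p" and m: "[(\<Sum>r\<in>{0..<int p}. m r) = 0] (mod int p)"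
  shows "[(\<Sum>i<p. m ((x + int i * c) mod int p)) = 0] (mod int p)"
proof (cases "int p dvd c")
  case True
  have "(x + int i * c) mod int p = x mod int p" for i
    using mod_add_right_eq[of x "int i * c" "int p"] dvd_mult[OF True, of "int i"] by simp
  then show ?thesis by (simp add: cong_0_iff)
next
  case False
  have p0: "0 < p" using p prime_gt_0_nat by blast
  have cop: "coprime c (int p)"
    using False p by (metis prime_imp_coprime coprime_commute prime_nat_int_transfer)
  let ?f = "\<lambda>i. (x + int i * c) mod int p"
  have inj: "inj_on ?f {..<p}"
  proof (rule inj_onI)
    fix i j assume ij: "i \<in> {..<p}" "j \<in> {..<p}" "?f i = ?f j"
    then have "[x + int i * c = x + int j * c] (mod int p)" by (simp add: cong_def)
    then have "[int i * c = int j * c] (mod int p)" using cong_add_lcancel by blast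
    then have "[int i = int j] (mod int p)" using cong_mult_rcancel[OF cop] by blast
    then show "i = j" using ij(1,2) by (simp add: cong_def)
  qed
  moreover have "?f ` {..<p} = {0..<int p}"
    using p0 by (intro card_subset_eq) (auto simp: card_image[OF inj])
  ultimately have "(\<Sum>i<p. m (?f i)) = (\<Sum>r\<in>{0..<int p}. m r)"
    by (metis (no_types, lifting) sum.reindex_cong)
  then show ?thesis using m by simp
qed

lemma GGS_pow_p_fixes_level2:
  assumes p: "prime p" and sum0: "[(\<Sum>i=1..p-1. e i) = 0] (mod int p)"
    and t: "t \<in> GGS_group p e" and v: "v \<in> level p 2"
  shows "(t [^]\<^bsub>AutT p\<^esub> p) v = v"
proof -
  obtain x y where xy: "v = [x, y]" "x \<in> {1..p}" "y \<in> {1..p}"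
    using v by (auto simp: level_def length_Suc_conv numeral_2_eq_2)
  obtain c m where cm: "shifts_level2 p t c m" "[(\<Sum>r\<in>{0..<int p}. m r) = 0] (mod int p)"
    using GGS_shifts_level2[OF prime_gt_0_nat[OF p] sum0 t] by blast
  obtain x' y' where 1: "x' \<in> {1..p}" "y' \<in> {1..p}" "(t [^]\<^bsub>AutT p\<^esub> p) [x, y] = [x', y']"
    "[int x' = int x + int p * c] (mod int p)"
    "[int y' = int y + (\<Sum>i<p. m ((int x mod int p + int i * c) mod int p))] (mod int p)"
    using shifts_level2_pow[OF cm(1), of p] xy(2,3) unfolding shifts_level2_def by blast
  have "[int x' = int x] (mod int p)" using 1(4) by (simp add: cong_def)
  moreover have "[int y' = int y] (mod int p)"
    using cong_trans[OF 1(5) cong_add[OF cong_refl sum_arith_progression_residues[OF p cm(2)]]] by simp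
  ultimately show ?thesis
    using letter_eq_of_cong 1(1-3) xy by metis
qed

text \<open>The section of \<open>k\<^sup>p\<close> at a vertex of level \<open>n\<close> is the \<open>p\<close>-th power of an element of the group,
  hence fixes two further levels.\<close>

lemma pow_p_level_stabilizer:
  assumes p: "prime p" and sum0: "[(\<Sum>i=1..p-1. e i) = 0] (mod int p)"
    and k: "k \<in> level_stabilizer p (GGS_group p e) n"
  shows "k [^]\<^bsub>AutT p\<^esub> p \<in> level_stabilizer p (GGS_group p e) (n + 2)"
proof -
  interpret G: subgroup "GGS_group p e" "AutT p" by (rule subgroup_GGS)
  have kG: "k \<in> GGS_group p e" using k by (simp add: level_stabilizer_def)
  then have kp: "k [^]\<^bsub>AutT p\<^esub> p \<in> GGS_group p e"
    using aut.subgroup_int_pow_closed[OF subgroup_GGS kG, of "int p"] by (simp add: int_pow_int)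
  have "(k [^]\<^bsub>AutT p\<^esub> p) w = w" if w: "w \<in> level p (n + 2)" for w
  proof -
    define u v where uv: "u = take n w" "v = drop n w"
    have wuv: "w = u @ v" by (simp add: uv)
    have "length u = n" "length v = 2" using w by (auto simp: uv level_def)
    moreover have "u @ v \<in> vertices p" using w wuv by (simp add: level_def)
    ultimately have u: "u \<in> level p n" "u \<in> vertices p" and v: "v \<in> level p 2" "v \<in> vertices p"
      by (auto simp: level_def)
    have ku: "k u = u" using k u by (simp add: level_stabilizer_def)
    note f = section_at_pow_fixed[OF GGS_tree_auts[OF kG] u(2) ku, of p]
    show ?thesis
      using section_at_spec[OF GGS_tree_auts[OF kp] u(2) v(2)] f
        GGS_pow_p_fixes_level2[OF p sum0 section_GGS[OF kG u(2)] v(1)]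
      by (simp add: wuv)
  qed
  then show ?thesis using kp by (simp add: level_stabilizer_def)
qed


section \<open>Recovering the generators as sections\<close>

text \<open>
  The section of \<open>ab\<close> at a letter \<open>x\<close> is that of \<open>b\<close> at \<open>x + 1\<close>, since \<open>a\<close> acts first and has trivial
  sections. Iterating from the letter \<open>p\<close>, the path visits \<open>1, \<dots>, p - 1\<close>, collecting
  \<open>a^(e 1) \<dots> a^(e (p - 1)) = 1\<close>, and then returns to \<open>p\<close>, where it collects \<open>b\<close>.
\<close>

lemma section_ab_pow_p:
  assumes p: "2 \<le> p" and sum0: "[(\<Sum>i=1..p-1. e i) = 0] (mod int p)"
  defines "t \<equiv> ggs_a p \<otimes>\<^bsub>AutT p\<^esub> ggs_b p e"
  shows "(t [^]\<^bsub>AutT p\<^esub> p) [p] = [p]" "section_at p [p] (t [^]\<^bsub>AutT p\<^esub> p) = ggs_b p e"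
proof -
  note tr = ggs_a_tree_auts ggs_b_tree_auts
  have t: "t \<in> tree_auts p" using aut.m_closed[of "ggs_a p" p "ggs_b p e"] tr by (simp add: t_def)
  have tk: "t [^]\<^bsub>AutT p\<^esub> k \<in> tree_auts p" for k :: nat
    using aut.nat_pow_closed[of t p k] t by simp
  have step: "t [x] = [x mod p + 1]" "section_at p [x] t = section_at p [x mod p + 1] (ggs_b p e)"
    if x: "x \<in> {1..p}" for x
  proof -
    have y: "x mod p + 1 \<in> {1..p}" using p by (auto simp: Suc_le_eq)
    have a: "ggs_a p [x] = [x mod p + 1]" using x by (simp add: ggs_a_def)
    show "t [x] = [x mod p + 1]"
      using x a ggs_b_letter[OF y] by (simp add: t_def AutT_mult_apply)
    have "section_at p [x] t = \<one>\<^bsub>AutT p\<^esub> \<otimes>\<^bsub>AutT p\<^esub> section_at p [x mod p + 1] (ggs_b p e)"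
      using section_at_mult[OF ggs_a_tree_auts ggs_b_tree_auts[of p e], of "[x]"] a x by (simp add: t_def section_ggs_a)
    then show "section_at p [x] t = section_at p [x mod p + 1] (ggs_b p e)"
      using section_at_closed[OF ggs_b_tree_auts[of p e], of "[x mod p + 1]"] y by simp
  qed
  have start: "(if k = 0 then p else k) \<in> {1..p}" "(if k = 0 then p else k) mod p = k" if "k < p" for k
    using that p by auto
  \<comment> \<open>After \<open>k\<close> steps the path is at letter \<open>k\<close>, except that it starts at \<open>p\<close> instead of \<open>0\<close>.\<close>
  have run: "(t [^]\<^bsub>AutT p\<^esub> k) [p] = [if k = 0 then p else k] \<and>
      section_at p [p] (t [^]\<^bsub>AutT p\<^esub> k) = ggs_a p [^]\<^bsub>AutT p\<^esub> (\<Sum>i=1..k. e i)" if "k < p" for k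
    using that
  proof (induction k)
    case 0
    then show ?case by (simp add: AutT_one_apply section_at_one)
  next
    case (Suc k)
    let ?x = "if k = 0 then p else k"
    have IH: "(t [^]\<^bsub>AutT p\<^esub> k) [p] = [?x]"
      "section_at p [p] (t [^]\<^bsub>AutT p\<^esub> k) = ggs_a p [^]\<^bsub>AutT p\<^esub> (\<Sum>i=1..k. e i)"
      using Suc by auto
    have x: "?x \<in> {1..p}" "?x mod p + 1 = Suc k" using start[of k] Suc.prems by auto
    have pV: "[p] \<in> vertices p" using p by simp
    have "(t [^]\<^bsub>AutT p\<^esub> Suc k) [p] = [Suc k]"
      using IH(1) step(1)[OF x(1)] x(2) pV by (simp add: AutT_mult_apply)
    moreover have "section_at p [p] (t [^]\<^bsub>AutT p\<^esub> Suc k) =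
        ggs_a p [^]\<^bsub>AutT p\<^esub> (\<Sum>i=1..k. e i) \<otimes>\<^bsub>AutT p\<^esub> section_at p [Suc k] (ggs_b p e)"
      using section_at_mult[OF tk t pV, of k] IH step(2)[OF x(1)] x(2) by simp
    moreover have "section_at p [Suc k] (ggs_b p e) = ggs_a p [^]\<^bsub>AutT p\<^esub> e (Suc k)"
      using section_ggs_b[of "Suc k" p e] Suc.prems by simp
    ultimately show ?case
      using aut.int_pow_mult[of "ggs_a p" p] tr(1) by simp
  qed
  have "p - 1 < p" "p - 1 \<noteq> 0" "Suc (p - 1) = p" using p by auto
  note r = run[OF this(1)] this
  have x: "p - 1 \<in> {1..p}" "(p - 1) mod p + 1 = p" using p by auto
  have pV: "[p] \<in> vertices p" using p by simp
  have b: "section_at p [p] (ggs_b p e) = ggs_b p e" using section_ggs_b[of p p e] p by simp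
  have pow: "t [^]\<^bsub>AutT p\<^esub> p = t [^]\<^bsub>AutT p\<^esub> (p - 1) \<otimes>\<^bsub>AutT p\<^esub> t"
    using aut.nat_pow_Suc[of p t "p - 1"] r(4) by simp
  show "(t [^]\<^bsub>AutT p\<^esub> p) [p] = [p]"
    using r step(1)[OF x(1)] x(2) pV by (simp add: pow AutT_mult_apply)
  have "section_at p [p] (t [^]\<^bsub>AutT p\<^esub> p) =
      ggs_a p [^]\<^bsub>AutT p\<^esub> (\<Sum>i=1..p-1. e i) \<otimes>\<^bsub>AutT p\<^esub> ggs_b p e"
    using section_at_mult[OF tk t pV, of "p - 1"] r step(2)[OF x(1)] x(2) b by (simp add: pow)
  then show "section_at p [p] (t [^]\<^bsub>AutT p\<^esub> p) = ggs_b p e"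
    using ggs_a_pow_cong[OF sum0] tr by simp
qed

text \<open>Powers of \<open>a\<close> permute the letters transitively and have trivial sections, so conjugation by
  them moves a section to another letter without changing it.\<close>

lemma section_conj_ggs_a_pow:
  assumes x: "x \<in> {1..p}" and y: "y \<in> {1..p}" and g: "g \<in> tree_auts p" "g [y] = [y]"
  defines "\<alpha> \<equiv> ggs_a p [^]\<^bsub>AutT p\<^esub> (int x - int y)"
  shows "section_at p [x] (inv\<^bsub>AutT p\<^esub> \<alpha> \<otimes>\<^bsub>AutT p\<^esub> g \<otimes>\<^bsub>AutT p\<^esub> \<alpha>) = section_at p [y] g"
proof -
  have \<alpha>: "\<alpha> \<in> tree_auts p" "\<alpha> [y] = [x]" "section_at p [y] \<alpha> = \<one>\<^bsub>AutT p\<^esub>"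
    using ggs_a_pow_tree_auts ggs_a_pow_transitive[OF y x] section_ggs_a_pow[OF y]
    by (simp_all add: \<alpha>_def)
  have "section_at p [y] g \<in> tree_auts p" using section_at_closed[OF g(1), of "[y]"] y by simp
  then show ?thesis using section_at_conj[OF \<alpha>(1) g(1), of "[y]"] \<alpha> g(2) y by simp
qed

lemma ggs_b_section_of_pow_p:
  assumes p: "2 \<le> p" and sum0: "[(\<Sum>i=1..p-1. e i) = 0] (mod int p)" and x: "x \<in> {1..p}"
  obtains t where "t \<in> GGS_group p e" "section_at p [x] (t [^]\<^bsub>AutT p\<^esub> p) = ggs_b p e"
proof -
  interpret G: subgroup "GGS_group p e" "AutT p" by (rule subgroup_GGS)
  define t where "t = ggs_a p \<otimes>\<^bsub>AutT p\<^esub> ggs_b p e"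
  define \<alpha> where "\<alpha> = ggs_a p [^]\<^bsub>AutT p\<^esub> (int x - int p)"
  have t: "t \<in> GGS_group p e" by (simp add: t_def ggs_a_in_GGS ggs_b_in_GGS)
  have \<alpha>: "\<alpha> \<in> GGS_group p e" by (simp add: \<alpha>_def ggs_a_pow_in_GGS)
  have c: "t \<in> tree_auts p" "\<alpha> \<in> tree_auts p" using t \<alpha> GGS_tree_auts by blast+
  have tp: "t [^]\<^bsub>AutT p\<^esub> p \<in> tree_auts p" using aut.nat_pow_closed[of t p p] c by simp
  have conj_pow: "(inv\<^bsub>AutT p\<^esub> \<alpha> \<otimes>\<^bsub>AutT p\<^esub> t \<otimes>\<^bsub>AutT p\<^esub> \<alpha>) [^]\<^bsub>AutT p\<^esub> (k::nat) =
      inv\<^bsub>AutT p\<^esub> \<alpha> \<otimes>\<^bsub>AutT p\<^esub> t [^]\<^bsub>AutT p\<^esub> k \<otimes>\<^bsub>AutT p\<^esub> \<alpha>" for k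
  proof (induction k)
    case (Suc k)
    have m: "inv\<^bsub>AutT p\<^esub> \<alpha> \<in> tree_auts p" "t [^]\<^bsub>AutT p\<^esub> k \<in> tree_auts p"
      using c aut.inv_closed[of \<alpha> p] aut.nat_pow_closed[of t p k] by auto
    have "\<alpha> \<otimes>\<^bsub>AutT p\<^esub> (inv\<^bsub>AutT p\<^esub> \<alpha> \<otimes>\<^bsub>AutT p\<^esub> z) = z" if "z \<in> tree_auts p" for z
      using that c m by (simp flip: aut.m_assoc)
    then show ?case using c m Suc
      by (simp add: aut.m_assoc aut.m_closed[simplified carrier_AutT])
  qed (use c aut.inv_closed[of \<alpha> p] in simp)
  show ?thesis
  proof (rule that)
    show "inv\<^bsub>AutT p\<^esub> \<alpha> \<otimes>\<^bsub>AutT p\<^esub> t \<otimes>\<^bsub>AutT p\<^esub> \<alpha> \<in> GGS_group p e" using t \<alpha> by simp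
    show "section_at p [x] ((inv\<^bsub>AutT p\<^esub> \<alpha> \<otimes>\<^bsub>AutT p\<^esub> t \<otimes>\<^bsub>AutT p\<^esub> \<alpha>) [^]\<^bsub>AutT p\<^esub> p) = ggs_b p e"
      using section_conj_ggs_a_pow[OF x _ tp, of p] section_ab_pow_p[OF p sum0] p
      unfolding conj_pow by (simp add: t_def \<alpha>_def)
  qed
qed

lemma ggs_a_in_of_pow:
  assumes p: "prime p" and k: "\<not> [k = 0] (mod int p)"
    and H: "subgroup H (AutT p)" "ggs_a p [^]\<^bsub>AutT p\<^esub> k \<in> H"
  shows "ggs_a p \<in> H"
proof -
  have "coprime k (int p)"
    using k p by (metis cong_0_iff prime_imp_coprime coprime_commute prime_nat_int_transfer)
  then obtain l where l: "[k * l = 1] (mod int p)" using cong_solve_coprime_int by blast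
  have a: "ggs_a p \<in> carrier (AutT p)" by (simp add: ggs_a_tree_auts)
  have "(ggs_a p [^]\<^bsub>AutT p\<^esub> k) [^]\<^bsub>AutT p\<^esub> l = ggs_a p"
    using aut.int_pow_pow[OF a] ggs_a_pow_cong[OF l] a by (simp add: aut.int_pow_1)
  then show ?thesis using aut.subgroup_int_pow_closed[OF H, of l] by simp
qed

text \<open>
  Surjectivity at level \<open>n\<close> alone does not carry the induction, because elements of the stabilizer
  of level \<open>n\<close> need not fix level \<open>n + 1\<close>; the second conjunct supplies, after conjugation, enough elements that do. It
  is in turn renewed by taking \<open>p\<close>-th powers.
\<close>

lemma GGS_sections_of_stabilizers:
  assumes p: "prime p" and nonzero: "\<exists>i\<in>{1..p-1}. \<not> [e i = 0] (mod int p)"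
    and sum0: "[(\<Sum>i=1..p-1. e i) = 0] (mod int p)" and u: "u \<in> level p n"
  defines "G \<equiv> GGS_group p e"
  shows "G \<subseteq> section_at p u ` level_stabilizer p G n \<and>
    ggs_b p e \<in> section_at p u ` level_stabilizer p G (Suc n)"
  using u
proof (induction n arbitrary: u)
  case 0
  then have u: "u = []" by (simp add: level_def)
  have s: "section_at p [] g = g" if "g \<in> G" for g
    using that GGS_tree_auts[of g p e]
    by (auto simp: G_def section_at_def tree_auts_def Bij_def extensional_def)
  have "level_stabilizer p G 0 = G"
    using GGS_tree_auts[of _ p e] by (auto simp: G_def level_stabilizer_def level_def tree_auts_def)
  moreover have "ggs_b p e \<in> level_stabilizer p G (Suc 0)"
    using ggs_b_in_GGS ggs_b_letter
    by (auto simp: G_def level_stabilizer_def level_def length_Suc_conv)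
  ultimately show ?case
    using s ggs_b_in_GGS[of p e] unfolding u by (auto simp: G_def image_iff) metis
next
  case (Suc n)
  have p2: "2 \<le> p" using p by (rule prime_ge_2_nat)
  have sG: "subgroup G (AutT p)" by (simp add: G_def subgroup_GGS)
  obtain v x where u: "u = v @ [x]" "v \<in> level p n" "v \<in> vertices p" "x \<in> {1..p}"
    using Suc.prems by (cases u rule: rev_cases) (auto simp: level_def)
  have sec: "section_at p u g = section_at p [x] (section_at p v g)" for g
    using u section_at_append[of v p "[x]" g] by simp
  note IH = Suc.IH[OF u(2)]
  have tree: "g \<in> tree_auts p" if "g \<in> G" for g using that GGS_tree_auts by (simp add: G_def)
  let ?H = "section_at p u ` level_stabilizer p G (Suc n)"
  have H: "subgroup ?H (AutT p)" by (rule subgroup_section_image[OF sG Suc.prems])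
  have "section_at p [y] (ggs_b p e) \<in> ?H" if y: "y \<in> {1..p}" for y
  proof -
    \<comment> \<open>Conjugate an element with section \<open>b\<close> at \<open>v\<close> by one whose section there moves \<open>y\<close> to \<open>x\<close>.\<close>
    define \<alpha> where "\<alpha> = ggs_a p [^]\<^bsub>AutT p\<^esub> (int x - int y)"
    have "\<alpha> \<in> G" by (simp add: \<alpha>_def G_def ggs_a_pow_in_GGS)
    then obtain h where h: "h \<in> level_stabilizer p G n" "section_at p v h = \<alpha>" using IH by blast
    obtain k where k: "k \<in> level_stabilizer p G (Suc n)" "section_at p v k = ggs_b p e"
      using IH by force
    have hG: "h \<in> G" "h v = v" and kG: "k \<in> G" using h k u by (auto simp: level_stabilizer_def)
    have kv: "k v = v"
    proof -
      have "k (v @ [x]) = k v @ section_at p v k [x]"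
        using section_at_spec[OF tree[OF kG] u(3), of "[x]"] u(4) by simp
      moreover have "k (v @ [x]) = v @ [x]" using k(1) Suc.prems u(1) by (simp add: level_stabilizer_def)
      ultimately show ?thesis using tree_auts_length[OF tree[OF kG] u(3)] by simp
    qed
    let ?g = "inv\<^bsub>AutT p\<^esub> h \<otimes>\<^bsub>AutT p\<^esub> k \<otimes>\<^bsub>AutT p\<^esub> h"
    have "section_at p v ?g = inv\<^bsub>AutT p\<^esub> \<alpha> \<otimes>\<^bsub>AutT p\<^esub> ggs_b p e \<otimes>\<^bsub>AutT p\<^esub> \<alpha>"
      using section_at_conj[OF tree[OF hG(1)] tree[OF kG] u(3) kv] hG(2) h(2) k(2) by simp
    then have "section_at p u ?g = section_at p [y] (ggs_b p e)"
      using section_conj_ggs_a_pow[OF u(4) y ggs_b_tree_auts ggs_b_letter[OF y]]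
      by (simp add: sec \<alpha>_def)
    then show ?thesis using level_stabilizer_conj[OF sG hG(1) k(1)] by (metis image_eqI)
  qed
  note sections_in = this
  have "ggs_b p e \<in> ?H" using sections_in[of p] section_ggs_b[of p p e] p2 by simp
  moreover have "ggs_a p \<in> ?H"
  proof -
    obtain i where i: "i \<in> {1..p-1}" "\<not> [e i = 0] (mod int p)" using nonzero by blast
    then have "i \<in> {1..p}" "i \<noteq> p" using p2 by auto
    then have "ggs_a p [^]\<^bsub>AutT p\<^esub> e i \<in> ?H"
      using sections_in[of i] section_ggs_b[of i p e] by simp
    then show ?thesis by (rule ggs_a_in_of_pow[OF p i(2) H])
  qed
  ultimately have "G \<subseteq> ?H" unfolding G_def by (intro GGS_subset) (use H in \<open>simp_all add: G_def\<close>)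
  moreover have "ggs_b p e \<in> section_at p u ` level_stabilizer p G (Suc (Suc n))"
  proof -
    obtain t where t: "t \<in> G" "section_at p [x] (t [^]\<^bsub>AutT p\<^esub> p) = ggs_b p e"
      using ggs_b_section_of_pow_p[OF p2 sum0 u(4)] by (auto simp: G_def)
    obtain k where k: "k \<in> level_stabilizer p G n" "section_at p v k = t" using IH t(1) by blast
    have "k \<in> G" "k v = v" using k(1) u(2) by (auto simp: level_stabilizer_def)
    then have "section_at p u (k [^]\<^bsub>AutT p\<^esub> p) = ggs_b p e"
      using section_at_pow_fixed(2)[OF tree u(3), of k p] k(2) t(2) by (simp add: sec)
    moreover have "k [^]\<^bsub>AutT p\<^esub> p \<in> level_stabilizer p G (Suc (Suc n))"
      using pow_p_level_stabilizer[OF p sum0, of k n] k(1) by (simp add: G_def)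
    ultimately show ?thesis by (metis image_eqI)
  qed
  ultimately show ?case by blast
qed

theorem proposition5p1:
  fixes p :: nat and e :: "nat \<Rightarrow> int"
  assumes "prime p"
    and nonzero: "\<exists>i\<in>{1..p-1}. \<not> [e i = 0] (mod int p)"
    and "[(\<Sum>i=1..p-1. e i) = 0] (mod int p)"
  shows "super_strongly_fractal p (GGS_group p e)"
proof -
  let ?G = "GGS_group p e"
  have "self_similar p ?G" by (simp add: self_similar_def subgroup_GGS section_GGS)
  moreover have "section_at p u ` level_stabilizer p ?G n = ?G" if "u \<in> level p n" for n u
  proof
    show "section_at p u ` level_stabilizer p ?G n \<subseteq> ?G"
      using that section_GGS by (auto simp: level_stabilizer_def level_def)
    show "?G \<subseteq> section_at p u ` level_stabilizer p ?G n"
      using GGS_sections_of_stabilizers[OF assms that] by blast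
  qed
  ultimately show ?thesis by (simp add: super_strongly_fractal_def)
qed

end
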